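(* Let $(X_\infty,f_\infty)$ be an equicontinuous, strongly uniformly expansive topological nonautonomous dynamical system such that each $f_n:X_n\to X_{n+1}$ is onto. Then for each $n\ge0$ there exists a metric $\rho_n$ on $X_n$ with the following properties: (i) The maps $f_n:(X_n,\rho_n)\to(X_{n+1},\rho_{n+1})$ expand small distances uniformly in $n$, i.e., there exist $\alpha>0$ and $\beta>1$ such that for any $n\ge0$ and $x,y\in X_n$, $\rho_n(x,y)<\alpha$ implies $\rho_{n+1}(f_n(x),f_n(y))\ge\beta\rho_n(x,y)$. (ii) The metrics $\rho_n$ and $d_n$ are uniformly equivalent, i.e., the sequence of maps $\pi_n:(X_n,d_n)\to(X_n,\rho_n)$, $x\mapsto x$, $n\ge0$, is uniformly equicontinuous and the same holds for the sequence $(\pi_n^{-1})_{n\ge0}$ of inverses.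
   Context: A topological nonautonomous dynamical system (NDS) $(X_\infty,f_\infty)$ consists of compact metric spaces $(X_n,d_n)$, $n\ge0$, and continuous maps $f_n:X_n\to X_{n+1}$. It is equicontinuous if for every $\varepsilon>0$ there is $\delta>0$ such that for all $n$, $d_n(x,y)<\delta$ implies $d_{n+1}(f_n(x),f_n(y))<\varepsilon$. Put $f_i^j:=f_{i+j-1}\circ\cdots\circ f_i$, $f_i^0=\mathrm{id}$, and $d_{i,N}(x,y):=\max_{0\le j\le N}d_{i+j}(f_i^j(x),f_i^j(y))$ for $x,y\in X_i$. The NDS is strongly uniformly expansive if there is $\delta>0$ such that for every $\varepsilon>0$ there is an integer $N\ge1$ such that for all $i\ge0$ and $x,y\in X_i$: $d_{i,N}(x,y)<\delta$ implies $d_i(x,y)<\varepsilon$. *)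

theory Defs
  imports "HOL-Analysis.Analysis"
begin

text \<open>
  The spaces \<open>X n\<close> are carriers inside one ambient type \<open>'a\<close>, with no relation between
  different \<open>n\<close> (they may overlap or be disjoint); any sequence of spaces can be presented
  this way by passing to a disjoint union. The metric \<open>d n\<close> and the map \<open>f n\<close> matter only
  on \<open>X n\<close>.
\<close>

definition topological_NDS ::
  "(nat \<Rightarrow> 'a set) \<Rightarrow> (nat \<Rightarrow> 'a \<Rightarrow> 'a \<Rightarrow> real) \<Rightarrow> (nat \<Rightarrow> 'a \<Rightarrow> 'a) \<Rightarrow> bool" where
  "topological_NDS X d f \<longleftrightarrow>
     (\<forall>n. Metric_space (X n) (d n) \<and>
          compact_space (Metric_space.mtopology (X n) (d n)) \<and>
          continuous_map (Metric_space.mtopology (X n) (d n))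
            (Metric_space.mtopology (X (Suc n)) (d (Suc n))) (f n))"

text \<open>Equicontinuity of a sequence \<open>g n : (X n, d n) \<rightarrow> (_, e n)\<close>, with \<open>\<delta>\<close> independent of \<open>n\<close>.\<close>

definition uniformly_equicontinuous ::
  "(nat \<Rightarrow> 'a set) \<Rightarrow> (nat \<Rightarrow> 'a \<Rightarrow> 'a \<Rightarrow> real) \<Rightarrow> (nat \<Rightarrow> 'b \<Rightarrow> 'b \<Rightarrow> real) \<Rightarrow>
   (nat \<Rightarrow> 'a \<Rightarrow> 'b) \<Rightarrow> bool" where
  "uniformly_equicontinuous X d e g \<longleftrightarrow>
     (\<forall>\<epsilon>>0. \<exists>\<delta>>0. \<forall>n. \<forall>x\<in>X n. \<forall>y\<in>X n. d n x y < \<delta> \<longrightarrow> e n (g n x) (g n y) < \<epsilon>)"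

definition equicontinuous_NDS ::
  "(nat \<Rightarrow> 'a set) \<Rightarrow> (nat \<Rightarrow> 'a \<Rightarrow> 'a \<Rightarrow> real) \<Rightarrow> (nat \<Rightarrow> 'a \<Rightarrow> 'a) \<Rightarrow> bool" where
  "equicontinuous_NDS X d f \<longleftrightarrow> uniformly_equicontinuous X d (\<lambda>n. d (Suc n)) f"

primrec NDS_iter :: "(nat \<Rightarrow> 'a \<Rightarrow> 'a) \<Rightarrow> nat \<Rightarrow> nat \<Rightarrow> 'a \<Rightarrow> 'a" where
  "NDS_iter f i 0 = id"
| "NDS_iter f i (Suc j) = f (i + j) \<circ> NDS_iter f i j"

definition Bowen_metric ::
  "(nat \<Rightarrow> 'a \<Rightarrow> 'a \<Rightarrow> real) \<Rightarrow> (nat \<Rightarrow> 'a \<Rightarrow> 'a) \<Rightarrow> nat \<Rightarrow> nat \<Rightarrow> 'a \<Rightarrow> 'a \<Rightarrow> real" where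
  "Bowen_metric d f i N x y =
     Max ((\<lambda>j. d (i + j) (NDS_iter f i j x) (NDS_iter f i j y)) ` {0..N})"

definition strongly_uniformly_expansive ::
  "(nat \<Rightarrow> 'a set) \<Rightarrow> (nat \<Rightarrow> 'a \<Rightarrow> 'a \<Rightarrow> real) \<Rightarrow> (nat \<Rightarrow> 'a \<Rightarrow> 'a) \<Rightarrow> bool" where
  "strongly_uniformly_expansive X d f \<longleftrightarrow>
     (\<exists>\<delta>>0. \<forall>\<epsilon>>0. \<exists>N\<ge>1. \<forall>i. \<forall>x\<in>X i. \<forall>y\<in>X i.
        Bowen_metric d f i N x y < \<delta> \<longrightarrow> d i x y < \<epsilon>)"

definition uniformly_expands_small_distances ::
  "(nat \<Rightarrow> 'a set) \<Rightarrow> (nat \<Rightarrow> 'a \<Rightarrow> 'a \<Rightarrow> real) \<Rightarrow> (nat \<Rightarrow> 'a \<Rightarrow> 'a) \<Rightarrow> bool" where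
  "uniformly_expands_small_distances X \<rho> f \<longleftrightarrow>
     (\<exists>\<alpha>>0. \<exists>\<beta>>1. \<forall>n. \<forall>x\<in>X n. \<forall>y\<in>X n.
        \<rho> n x y < \<alpha> \<longrightarrow> \<rho> (Suc n) (f n x) (f n y) \<ge> \<beta> * \<rho> n x y)"

definition uniformly_equivalent_metrics ::
  "(nat \<Rightarrow> 'a set) \<Rightarrow> (nat \<Rightarrow> 'a \<Rightarrow> 'a \<Rightarrow> real) \<Rightarrow> (nat \<Rightarrow> 'a \<Rightarrow> 'a \<Rightarrow> real) \<Rightarrow> bool" where
  "uniformly_equivalent_metrics X d \<rho> \<longleftrightarrow>
     uniformly_equicontinuous X d \<rho> (\<lambda>n x. x) \<and>
     uniformly_equicontinuous X \<rho> d (\<lambda>n x. x)"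

end

theory Submission
  imports Defs
begin

text \<open>
  Fix an expansivity threshold \<open>\<delta>\<close> and call the first time at which the orbits of two points are
  at distance at least \<open>\<delta>\<close> their escape time \<open>\<tau>\<close>. The quantity \<open>q = \<theta> ^ \<tau>\<close> is expanded by the
  factor \<open>1 / \<theta>\<close> in each step until escape, since the escape time drops by one, and strong uniform
  expansivity together with equicontinuity makes it uniformly equivalent to the given metrics.
  It need not satisfy the triangle inequality. However, if \<open>N\<close> is the expansivity time that turns distances below
  \<open>\<delta>\<close> into distances below \<open>\<delta> / 3\<close>, then the endpoints of a chain of three links escape at most
  \<open>N\<close> steps before the first of the links does. With \<open>\<theta> ^ N = 1 / 2\<close> this gives
  \<open>q x w \<le> 2 * max (q x y) (max (q y z) (q z w))\<close>, and
  Frink's chain construction (\<open>le_2_chain_metric\<close>) provides genuine metrics \<open>D\<close> with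
  \<open>D \<le> q \<le> 2 * D\<close>.

  The comparison costs a factor \<open>2\<close>, so a single step need not expand \<open>D\<close>. After
  \<open>2 * N\<close> steps without escape \<open>q\<close> has grown by a factor of at least \<open>4\<close>, hence \<open>D\<close> by at least \<open>2\<close>
  (\<open>chain_metric_doubles\<close>). A weighted sum of \<open>D\<close> along the first \<open>2 * N\<close> points of the orbits,
  an adapted metric in the sense of Mather, spreads this expansion evenly over the steps (\<open>adapted_sum_expands\<close>).
\<close>

section \<open>The chain metric of a distance with a weak triangle inequality\<close>

fun chain_length :: "('a \<Rightarrow> 'a \<Rightarrow> real) \<Rightarrow> 'a list \<Rightarrow> real" where
  "chain_length q (x # y # zs) = q x y + chain_length q (y # zs)"
| "chain_length q _ = 0"

text \<open>
  The intermediate points are separated from the endpoints so that the infimum ranges over a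
  nonempty set even for endpoints outside \<open>A\<close>; symmetry and nonnegativity then hold everywhere,
  as \<^const>\<open>Metric_space\<close> demands.
\<close>

definition chain_metric :: "'a set \<Rightarrow> ('a \<Rightarrow> 'a \<Rightarrow> real) \<Rightarrow> 'a \<Rightarrow> 'a \<Rightarrow> real" where
  "chain_metric A q x y = (INF zs \<in> lists A. chain_length q (x # zs @ [y]))"

lemma chain_length_nonneg:
  assumes "\<And>x y. 0 \<le> q x y"
  shows "0 \<le> chain_length q zs"
  by (induction zs rule: induct_list012) (auto simp: assms)

lemma chain_length_append:
  "chain_length q (xs @ v # ys) = chain_length q (xs @ [v]) + chain_length q (v # ys)"
proof (induction xs)
  case Nil
  then show ?case by simp
next
  case (Cons x xs)
  then show ?case by (cases xs) auto
qed

lemma chain_length_rev: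
  assumes "\<And>x y. q x y = q y x"
  shows "chain_length q (rev zs) = chain_length q zs"
proof (induction zs rule: induct_list012)
  case (3 x y zs)
  then show ?case
    using chain_length_append[of q "rev zs" y "[x]"] assms[of x y] by simp
qed auto

text \<open>
  A chain can be cut at a link, which belongs to neither side, so that the two sides obey
  prescribed bounds. For two equal bounds this is the link that contains the midpoint.
\<close>

lemma chain_split:
  assumes nonneg: "\<And>x y. 0 \<le> q x y"
    and "chain_length q (x # y # zs) \<le> a + b" "0 \<le> a" "0 \<le> b"
  shows "\<exists>us u v vs. x # y # zs = us @ u # v # vs \<and>
           chain_length q (us @ [u]) \<le> a \<and> chain_length q (v # vs) \<le> b"
  using assms(2-4)
proof (induction zs arbitrary: x y a)
  case Nil
  have "x # y # [] = [] @ x # y # [] \<and> chain_length q ([] @ [x]) \<le> a \<and>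
      chain_length q (y # []) \<le> b"
    using Nil by simp
  then show ?case by blast
next
  case (Cons z zs)
  show ?case
  proof (cases "chain_length q (y # z # zs) \<le> b")
    case True
    then have "x # y # z # zs = [] @ x # y # z # zs \<and> chain_length q ([] @ [x]) \<le> a \<and>
        chain_length q (y # z # zs) \<le> b"
      using Cons.prems by simp
    then show ?thesis by blast
  next
    case False
    then have "chain_length q (y # z # zs) \<le> (a - q x y) + b" "0 \<le> a - q x y"
      using Cons.prems by auto
    from Cons.IH[OF this \<open>0 \<le> b\<close>] obtain us u v vs where
      s: "y # z # zs = us @ u # v # vs" "chain_length q (us @ [u]) \<le> a - q x y"
        "chain_length q (v # vs) \<le> b"
      by blast
    have "chain_length q ((x # us) @ [u]) \<le> a"
      using s by (cases us) auto
    then have "x # y # z # zs = (x # us) @ u # v # vs \<and>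
        chain_length q ((x # us) @ [u]) \<le> a \<and> chain_length q (v # vs) \<le> b"
      using s by simp
    then show ?thesis by blast
  qed
qed

locale weak_ultrametric =
  fixes A :: "'a set" and q :: "'a \<Rightarrow> 'a \<Rightarrow> real"
  assumes nonneg: "\<And>x y. 0 \<le> q x y"
    and sym: "\<And>x y. q x y = q y x"
    and refl: "\<And>x. q x x = 0"
    and separated: "\<And>x y. x \<in> A \<Longrightarrow> y \<in> A \<Longrightarrow> q x y = 0 \<Longrightarrow> x = y"
    and three_links: "\<And>x y z w b. \<lbrakk>x \<in> A; y \<in> A; z \<in> A; w \<in> A;
          q x y \<le> b; q y z \<le> b; q z w \<le> b\<rbrakk> \<Longrightarrow> q x w \<le> 2 * b"
begin

text \<open>
  Frink's estimate. Cut the chain at the link containing its midpoint. By induction each of the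
  two remaining parts, of length at most half of the total, joins points at \<open>q\<close>-distance
  at most the total length; the same is true of the link itself, and the inequality for three links
  applies.
\<close>

lemma le_2_chain_length:
  assumes "zs \<noteq> []" "set zs \<subseteq> A"
  shows "q (hd zs) (last zs) \<le> 2 * chain_length q zs"
  using assms
proof (induction "length zs" arbitrary: zs rule: less_induct)
  case less
  show ?case
  proof (cases "\<exists>x. zs = [x]")
    case True
    then show ?thesis by (auto simp: refl)
  next
    case False
    then obtain x y ys where zs: "zs = x # y # ys"
      using less.prems by (metis list.exhaust)
    define a where "a = chain_length q zs"
    have "0 \<le> a"
      unfolding a_def by (rule chain_length_nonneg[OF nonneg])
    then have "\<exists>us u v vs. x # y # ys = us @ u # v # vs \<and>
        chain_length q (us @ [u]) \<le> a / 2 \<and> chain_length q (v # vs) \<le> a / 2"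
      by (intro chain_split nonneg) (simp_all add: a_def zs)
    then obtain us u v vs where split: "zs = us @ u # v # vs"
      and a1: "chain_length q (us @ [u]) \<le> a / 2" and a2: "chain_length q (v # vs) \<le> a / 2"
      unfolding zs by blast
    have "a = chain_length q (us @ [u]) + (q u v + chain_length q (v # vs))"
      unfolding a_def split by (subst chain_length_append) simp
    then have link: "q u v \<le> a"
      using chain_length_nonneg[of q "us @ [u]"] chain_length_nonneg[of q "v # vs"] nonneg
      by auto
    have left: "q (hd zs) u \<le> a"
      using less.hyps[of "us @ [u]"] less.prems a1 unfolding split by (cases us) auto
    have right: "q v (last zs) \<le> a"
      using less.hyps[of "v # vs"] less.prems a2 unfolding split by auto
    have "hd zs \<in> A" "u \<in> A" "v \<in> A" "last zs \<in> A"
      using less.prems last_in_set[of zs] hd_in_set[of zs] unfolding split by auto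
    then show ?thesis
      using three_links[OF _ _ _ _ left link right] unfolding a_def by blast
  qed
qed

lemma chain_metric_le_length:
  assumes "set zs \<subseteq> A"
  shows "chain_metric A q x y \<le> chain_length q (x # zs @ [y])"
  unfolding chain_metric_def
  by (rule cINF_lower) (use assms in \<open>auto intro!: bdd_belowI[of _ 0] chain_length_nonneg nonneg\<close>)

lemma chain_metric_greatest:
  assumes "\<And>zs. set zs \<subseteq> A \<Longrightarrow> b \<le> chain_length q (x # zs @ [y])"
  shows "b \<le> chain_metric A q x y"
  unfolding chain_metric_def by (rule cINF_greatest) (use assms in auto)

lemma chain_metric_le: "chain_metric A q x y \<le> q x y"
  using chain_metric_le_length[of "[]" x y] by simp

lemma le_2_chain_metric:
  assumes "x \<in> A" "y \<in> A"
  shows "q x y \<le> 2 * chain_metric A q x y"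
proof -
  have "q x y / 2 \<le> chain_metric A q x y"
  proof (rule chain_metric_greatest)
    fix zs assume "set zs \<subseteq> A"
    then show "q x y / 2 \<le> chain_length q (x # zs @ [y])"
      using le_2_chain_length[of "x # zs @ [y]"] assms by simp
  qed
  then show ?thesis by simp
qed

lemma chain_metric_nonneg: "0 \<le> chain_metric A q x y"
  by (intro chain_metric_greatest chain_length_nonneg nonneg)

lemma chain_metric_sym_le: "chain_metric A q x y \<le> chain_metric A q y x"
proof (rule chain_metric_greatest)
  fix zs assume "set zs \<subseteq> A"
  then show "chain_metric A q x y \<le> chain_length q (y # zs @ [x])"
    using chain_metric_le_length[of "rev zs" x y] chain_length_rev[of q "y # zs @ [x]"] sym
    by simp
qed

lemma chain_metric_triangle:
  assumes "y \<in> A"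
  shows "chain_metric A q x z \<le> chain_metric A q x y + chain_metric A q y z"
proof -
  have "chain_metric A q x z - chain_metric A q y z \<le> chain_metric A q x y"
  proof (rule chain_metric_greatest)
    fix us assume us: "set us \<subseteq> A"
    have "chain_metric A q x z - chain_length q (x # us @ [y]) \<le> chain_metric A q y z"
    proof (rule chain_metric_greatest)
      fix vs assume vs: "set vs \<subseteq> A"
      have "chain_metric A q x z \<le> chain_length q (x # (us @ y # vs) @ [z])"
        using us vs assms by (intro chain_metric_le_length) auto
      also have "\<dots> = chain_length q (x # us @ [y]) + chain_length q (y # vs @ [z])"
        using chain_length_append[of q "x # us" y "vs @ [z]"] by simp
      finally show "chain_metric A q x z - chain_length q (x # us @ [y])
          \<le> chain_length q (y # vs @ [z])" by simp
    qed
    then show "chain_metric A q x z - chain_metric A q y z \<le> chain_length q (x # us @ [y])"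
      by simp
  qed
  then show ?thesis by simp
qed

lemma Metric_space_chain_metric: "Metric_space A (chain_metric A q)"
proof
  fix x y z
  show "0 \<le> chain_metric A q x y"
    by (rule chain_metric_nonneg)
  show "chain_metric A q x y = chain_metric A q y x"
    by (intro antisym chain_metric_sym_le)
  show "chain_metric A q x y = 0 \<longleftrightarrow> x = y" if "x \<in> A" "y \<in> A"
    using that chain_metric_le[of x y] le_2_chain_metric[of x y] chain_metric_nonneg[of x y]
      nonneg[of x y] separated[of x y] refl[of x]
    by (auto intro: antisym)
  show "chain_metric A q x z \<le> chain_metric A q x y + chain_metric A q y z"
    if "x \<in> A" "y \<in> A" "z \<in> A"
    using that by (intro chain_metric_triangle)
qed

end

section \<open>Orbits\<close>

lemma NDS_iter_add: "NDS_iter f (n + k) j (NDS_iter f n k x) = NDS_iter f n (k + j) x"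
  by (induction j) (auto simp: add.assoc)

lemma NDS_iter_Suc: "NDS_iter f (Suc n) j (f n x) = NDS_iter f n (Suc j) x"
  using NDS_iter_add[of f n 1 j x] by simp

lemma NDS_iter_in:
  assumes "\<And>n. f n \<in> X n \<rightarrow> X (Suc n)" and "x \<in> X n"
  shows "NDS_iter f n j x \<in> X (n + j)"
  by (induction j) (use assms funcset_mem in auto)

lemma equicontinuous_orbits:
  assumes equi: "equicontinuous_NDS X d f"
    and maps: "\<And>n. f n \<in> X n \<rightarrow> X (Suc n)"
    and "0 < \<epsilon>"
  shows "\<exists>\<eta>>0. \<forall>n. \<forall>x\<in>X n. \<forall>y\<in>X n. d n x y < \<eta> \<longrightarrow>
           (\<forall>j<m. d (n + j) (NDS_iter f n j x) (NDS_iter f n j y) < \<epsilon>)"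
proof (induction m)
  case 0
  show ?case by (rule exI[of _ 1]) simp
next
  case (Suc m)
  then obtain \<eta> where \<eta>: "\<eta> > 0" "\<forall>n. \<forall>x\<in>X n. \<forall>y\<in>X n. d n x y < \<eta> \<longrightarrow>
      (\<forall>j<m. d (n + j) (NDS_iter f n j x) (NDS_iter f n j y) < \<epsilon>)"
    by (elim exE conjE) (rule that)
  obtain \<eta>' where \<eta>': "\<eta>' > 0"
    "\<forall>n. \<forall>x\<in>X n. \<forall>y\<in>X n. d n x y < \<eta>' \<longrightarrow> d (Suc n) (f n x) (f n y) < \<eta>"
    using equi[unfolded equicontinuous_NDS_def uniformly_equicontinuous_def, rule_format,
        OF \<open>\<eta> > 0\<close>]
    by (elim exE conjE) (rule that)
  have "d (n + j) (NDS_iter f n j x) (NDS_iter f n j y) < \<epsilon>"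
    if "x \<in> X n" "y \<in> X n" "d n x y < min \<epsilon> \<eta>'" "j < Suc m" for n x y j
  proof (cases j)
    case 0
    then show ?thesis using that by simp
  next
    case (Suc i)
    then show ?thesis
      using \<eta>(2)[rule_format, of "f n x" "Suc n" "f n y" i] \<eta>'(2)[rule_format, of x n y] that
        funcset_mem[OF maps] NDS_iter_Suc[of f n i]
      by simp
  qed
  moreover have "0 < min \<epsilon> \<eta>'"
    using \<open>0 < \<epsilon>\<close> \<open>\<eta>' > 0\<close> by simp
  ultimately show ?case
    by blast
qed

section \<open>The escape distance\<close>

text \<open>
  The distance \<open>\<delta> / 3\<close> is chosen because the endpoints of a chain of three links shorter than \<open>\<delta> / 3\<close>
  are closer than \<open>\<delta>\<close>. The rate \<open>\<theta>\<close> is normalised so that a loss of \<open>N\<close> steps costs the factor \<open>2\<close>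
  for which \<^locale>\<open>weak_ultrametric\<close> is made.
\<close>

locale expansive_NDS =
  fixes X :: "nat \<Rightarrow> 'a set" and d :: "nat \<Rightarrow> 'a \<Rightarrow> 'a \<Rightarrow> real" and f :: "nat \<Rightarrow> 'a \<Rightarrow> 'a"
    and \<delta> \<theta> :: real and N :: nat
  assumes metric: "\<And>n. Metric_space (X n) (d n)"
    and maps: "\<And>n. f n \<in> X n \<rightarrow> X (Suc n)"
    and delta_pos: "0 < \<delta>"
    and theta_pos: "0 < \<theta>" and theta_less_1: "\<theta> < 1" and theta_power: "\<theta> ^ N = 1 / 2"
    and expansive: "\<And>\<epsilon>. 0 < \<epsilon> \<Longrightarrow> \<exists>M. \<forall>n. \<forall>x\<in>X n. \<forall>y\<in>X n.
          Bowen_metric d f n M x y < \<delta> \<longrightarrow> d n x y < \<epsilon>"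
    and expansive_third: "\<And>n x y. \<lbrakk>x \<in> X n; y \<in> X n; Bowen_metric d f n N x y < \<delta>\<rbrakk>
          \<Longrightarrow> d n x y < \<delta> / 3"
begin

definition close_until :: "nat \<Rightarrow> nat \<Rightarrow> 'a \<Rightarrow> 'a \<Rightarrow> bool" where
  "close_until n m x y \<longleftrightarrow> (\<forall>j<m. d (n + j) (NDS_iter f n j x) (NDS_iter f n j y) < \<delta>)"

definition escape_dist :: "nat \<Rightarrow> 'a \<Rightarrow> 'a \<Rightarrow> real" where
  "escape_dist n x y = (if x = y then 0
     else \<theta> ^ (LEAST j. \<delta> \<le> d (n + j) (NDS_iter f n j x) (NDS_iter f n j y)))"

lemma iter_in: "x \<in> X n \<Longrightarrow> NDS_iter f n j x \<in> X (n + j)"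
  by (rule NDS_iter_in[where X = X and f = f, OF maps])

lemma Bowen_less_iff: "Bowen_metric d f n M x y < \<delta> \<longleftrightarrow> close_until n (Suc M) x y"
  unfolding Bowen_metric_def close_until_def by (subst Max_less_iff) (auto simp: less_Suc_eq_le)

lemma close_until_mono: "close_until n m x y \<Longrightarrow> l \<le> m \<Longrightarrow> close_until n l x y"
  by (auto simp: close_until_def)

lemma close_until_add_iff:
  "close_until n (k + m) x y \<longleftrightarrow>
     close_until n k x y \<and> close_until (n + k) m (NDS_iter f n k x) (NDS_iter f n k y)"
proof -
  have "(\<forall>j<k + m. P j) \<longleftrightarrow> (\<forall>j<k. P j) \<and> (\<forall>j<m. P (k + j))" for P :: "nat \<Rightarrow> bool"
    by (metis add_diff_inverse_nat add_less_cancel_left trans_less_add1)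
  then show ?thesis
    unfolding close_until_def NDS_iter_add by (simp add: add.assoc)
qed

lemma close_forever_imp_eq:
  assumes "x \<in> X n" "y \<in> X n" "\<And>m. close_until n m x y"
  shows "x = y"
proof (rule ccontr)
  interpret Metric_space "X n" "d n" by (rule metric)
  assume "x \<noteq> y"
  then have "0 < d n x y" using assms by simp
  then obtain M where "\<forall>n'. \<forall>x'\<in>X n'. \<forall>y'\<in>X n'.
      Bowen_metric d f n' M x' y' < \<delta> \<longrightarrow> d n' x' y' < d n x y"
    using expansive by blast
  then show False using assms Bowen_less_iff by blast
qed

lemma power_le_iff: "\<theta> ^ i \<le> \<theta> ^ j \<longleftrightarrow> j \<le> i"
  using theta_pos theta_less_1 by simp

text \<open>
  The values of the escape distance are \<open>0\<close> and powers of \<open>\<theta>\<close>, so comparisons with powers of \<open>\<theta>\<close>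
  determine it. The case of orbits that never escape fits in because, by expansivity, it occurs for
  equal points only, where the distance is defined to be \<open>0\<close>.
\<close>

lemma escape_dist_le_iff:
  assumes "x \<in> X n" "y \<in> X n"
  shows "escape_dist n x y \<le> \<theta> ^ m \<longleftrightarrow> close_until n m x y"
proof (cases "x = y")
  case True
  have "d (n + j) (NDS_iter f n j y) (NDS_iter f n j y) = 0" for j
    using Metric_space.zero[OF metric iter_in iter_in] assms by blast
  then show ?thesis
    using True theta_pos delta_pos by (simp add: escape_dist_def close_until_def)
next
  case False
  define P where "P j \<longleftrightarrow> \<delta> \<le> d (n + j) (NDS_iter f n j x) (NDS_iter f n j y)" for j
  have "\<exists>j. P j"
    using close_forever_imp_eq[OF assms] False
    unfolding close_until_def P_def by (meson not_le)
  have "m \<le> (LEAST j. P j) \<longleftrightarrow> (\<forall>j<m. \<not> P j)"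
    using LeastI_ex[OF \<open>\<exists>j. P j\<close>] Least_le[of P] not_less_Least[of _ P]
    by (meson not_less order_less_le_trans)
  then show ?thesis
    using False by (simp add: escape_dist_def power_le_iff close_until_def P_def not_le)
qed

lemma escape_dist_cases:
  obtains "escape_dist n x y = 0" | m where "escape_dist n x y = \<theta> ^ m"
  unfolding escape_dist_def by (cases "x = y") auto

lemma escape_dist_nonneg: "0 \<le> escape_dist n x y"
  using theta_pos by (simp add: escape_dist_def)

lemma escape_dist_eq_0_iff: "escape_dist n x y = 0 \<longleftrightarrow> x = y"
  using theta_pos by (simp add: escape_dist_def)

lemma escape_dist_sym: "escape_dist n x y = escape_dist n y x"
  using Metric_space.commute[OF metric] by (simp add: escape_dist_def)

text \<open>
  At a time \<open>j < m - N\<close> there are still \<open>N\<close> further steps of \<open>\<delta>\<close>-closeness ahead, which is what the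
  choice of \<open>N\<close> asks for at the points of the orbits at time \<open>j\<close>.
\<close>

lemma close_until_third:
  assumes "x \<in> X n" "y \<in> X n" "close_until n m x y" "j < m - N"
  shows "d (n + j) (NDS_iter f n j x) (NDS_iter f n j y) < \<delta> / 3"
proof -
  have "close_until n (j + Suc N) x y"
    by (rule close_until_mono[OF assms(3)]) (use assms(4) in simp)
  then show ?thesis
    using expansive_third[OF iter_in iter_in] assms
    by (simp add: close_until_add_iff Bowen_less_iff del: add_Suc_right)
qed

lemma close_until_three_links:
  assumes "x \<in> X n" "y \<in> X n" "z \<in> X n" "w \<in> X n"
    and "close_until n m x y" "close_until n m y z" "close_until n m z w"
  shows "close_until n (m - N) x w"
  unfolding close_until_def
proof (intro allI impI)
  fix j assume j: "j < m - N"
  interpret Metric_space "X (n + j)" "d (n + j)" by (rule metric)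
  let ?i = "NDS_iter f n j"
  have "d (n + j) (?i x) (?i w) \<le> d (n + j) (?i x) (?i y) + d (n + j) (?i y) (?i w)"
    "d (n + j) (?i y) (?i w) \<le> d (n + j) (?i y) (?i z) + d (n + j) (?i z) (?i w)"
    using assms by (auto intro!: triangle iter_in)
  then show "d (n + j) (?i x) (?i w) < \<delta>"
    using close_until_third[OF assms(1,2,5) j] close_until_third[OF assms(2,3,6) j]
      close_until_third[OF assms(3,4,7) j] by linarith
qed

lemma escape_dist_three_links:
  assumes X: "x \<in> X n" "y \<in> X n" "z \<in> X n" "w \<in> X n"
    and le: "escape_dist n x y \<le> b" "escape_dist n y z \<le> b" "escape_dist n z w \<le> b"
  shows "escape_dist n x w \<le> 2 * b"
proof -
  \<comment> \<open>It suffices to bound by the largest of the three distances, which is \<open>0\<close> or a power of \<open>\<theta>\<close>.\<close>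
  define c where "c = max (escape_dist n x y) (max (escape_dist n y z) (escape_dist n z w))"
  have c: "escape_dist n x y \<le> c" "escape_dist n y z \<le> c" "escape_dist n z w \<le> c" "c \<le> b"
    unfolding c_def using le by auto
  have "c = 0 \<or> (\<exists>m. c = \<theta> ^ m)"
    unfolding c_def max_def by (metis escape_dist_cases)
  then have "escape_dist n x w \<le> 2 * c"
  proof
    assume "c = 0"
    then have "x = y" "y = z" "z = w"
      using c escape_dist_nonneg by (metis antisym escape_dist_eq_0_iff)+
    then show ?thesis using \<open>c = 0\<close> by (simp add: escape_dist_def)
  next
    assume "\<exists>m. c = \<theta> ^ m"
    then obtain m where m: "c = \<theta> ^ m" by blast
    then have "close_until n (m - N) x w"
      using X c close_until_three_links[of x n y z w m] by (simp add: escape_dist_le_iff)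
    then have "escape_dist n x w \<le> \<theta> ^ (m - N)"
      using X by (simp add: escape_dist_le_iff)
    also have "\<dots> = 2 * \<theta> ^ N * \<theta> ^ (m - N)"
      using theta_power by simp
    also have "\<dots> = 2 * \<theta> ^ (N + (m - N))"
      by (simp add: power_add)
    \<comment> \<open>For \<open>m < N\<close> the truncated difference is \<open>0\<close> and this is an inequality.\<close>
    also have "\<dots> \<le> 2 * \<theta> ^ m"
      using power_le_iff[of "N + (m - N)" m] by simp
    finally show ?thesis using m by simp
  qed
  then show ?thesis using \<open>c \<le> b\<close> by simp
qed

sublocale escape: weak_ultrametric "X n" "escape_dist n" for n
  by unfold_locales
    (auto simp: escape_dist_nonneg escape_dist_sym escape_dist_eq_0_iff
      intro: escape_dist_three_links)

abbreviation D :: "nat \<Rightarrow> 'a \<Rightarrow> 'a \<Rightarrow> real" where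
  "D n \<equiv> chain_metric (X n) (escape_dist n)"

text \<open>
  If the orbits have not escaped by time \<open>k\<close>, then the escape time of the \<open>k\<close>-th images is lower by \<open>k\<close>.
  If the \<open>k\<close>-th images coincide, the orbits never escape and expansivity makes the points equal.
\<close>

lemma escape_dist_expands:
  assumes "x \<in> X n" "y \<in> X n" "close_until n k x y"
  shows "escape_dist n x y \<le> \<theta> ^ k * escape_dist (n + k) (NDS_iter f n k x) (NDS_iter f n k y)"
proof -
  let ?q = "escape_dist (n + k) (NDS_iter f n k x) (NDS_iter f n k y)"
  have shift: "close_until n (k + m) x y" if "?q \<le> \<theta> ^ m" for m
    using that assms by (simp add: close_until_add_iff escape_dist_le_iff iter_in)
  show ?thesis
  proof (cases rule: escape_dist_cases[of "n + k" "NDS_iter f n k x" "NDS_iter f n k y"])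
    case 1
    then have "close_until n m x y" for m
      using shift[of m] theta_pos by (simp add: close_until_mono)
    then have "x = y" using close_forever_imp_eq assms by blast
    then show ?thesis by (simp add: escape_dist_def)
  next
    case (2 m)
    then have "escape_dist n x y \<le> \<theta> ^ (k + m)"
      using shift[of m] assms by (simp add: escape_dist_le_iff)
    then show ?thesis using 2 by (simp add: power_add)
  qed
qed

lemma chain_metric_small_imp_close:
  assumes "x \<in> X n" "y \<in> X n" "D n x y < \<theta> ^ m / 2"
  shows "close_until n m x y"
  using escape.le_2_chain_metric[OF assms(1,2)] assms
  by (simp add: escape_dist_le_iff[symmetric])

text \<open>
  Over \<open>2 * N\<close> steps the escape distance grows by \<open>1 / \<theta> ^ (2 * N) = 4\<close>, of which comparison with the
  chain metric loses a factor \<open>2\<close>.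
\<close>

lemma chain_metric_doubles:
  assumes "x \<in> X n" "y \<in> X n" "D n x y < \<theta> ^ (2 * N) / 2"
  shows "2 * D n x y \<le> D (n + 2 * N) (NDS_iter f n (2 * N) x) (NDS_iter f n (2 * N) y)"
proof -
  let ?x = "NDS_iter f n (2 * N) x" and ?y = "NDS_iter f n (2 * N) y"
  have "\<theta> ^ (2 * N) = (1 / 2) ^ 2"
    by (simp only: power_even_eq theta_power)
  then have "\<theta> ^ (2 * N) = 1 / 4"
    by (simp add: power2_eq_square)
  have "4 * D n x y \<le> 4 * escape_dist n x y"
    using escape.chain_metric_le by simp
  also have "\<dots> \<le> escape_dist (n + 2 * N) ?x ?y"
    using escape_dist_expands[OF assms(1,2) chain_metric_small_imp_close[OF assms]]
      \<open>\<theta> ^ (2 * N) = 1 / 4\<close> by simp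
  also have "\<dots> \<le> 2 * D (n + 2 * N) ?x ?y"
    by (rule escape.le_2_chain_metric) (auto intro: iter_in assms)
  finally show ?thesis by simp
qed

lemma chain_metric_uniformly_finer:
  "uniformly_equicontinuous X D d (\<lambda>n x. x)"
  unfolding uniformly_equicontinuous_def
proof (intro allI impI)
  fix \<epsilon> :: real assume "0 < \<epsilon>"
  then obtain M where M: "\<And>n x y. \<lbrakk>x \<in> X n; y \<in> X n; close_until n (Suc M) x y\<rbrakk> \<Longrightarrow> d n x y < \<epsilon>"
    using expansive Bowen_less_iff by metis
  then have "\<forall>n. \<forall>x\<in>X n. \<forall>y\<in>X n. D n x y < \<theta> ^ Suc M / 2 \<longrightarrow> d n x y < \<epsilon>"
    using chain_metric_small_imp_close by blast
  moreover have "0 < \<theta> ^ Suc M / 2"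
    using theta_pos by simp
  ultimately show "\<exists>\<eta>>0. \<forall>n. \<forall>x\<in>X n. \<forall>y\<in>X n. D n x y < \<eta> \<longrightarrow> d n x y < \<epsilon>"
    by blast
qed

lemma chain_metric_uniformly_coarser:
  assumes "equicontinuous_NDS X d f"
  shows "uniformly_equicontinuous X d D (\<lambda>n x. x)"
  unfolding uniformly_equicontinuous_def
proof (intro allI impI)
  fix \<epsilon> :: real assume "0 < \<epsilon>"
  then obtain m where m: "\<theta> ^ m < \<epsilon>"
    using real_arch_pow_inv theta_less_1 by blast
  obtain \<eta> where \<eta>: "\<eta> > 0"
    "\<And>n x y. \<lbrakk>x \<in> X n; y \<in> X n; d n x y < \<eta>\<rbrakk> \<Longrightarrow> close_until n m x y"
    using equicontinuous_orbits[where X = X and f = f, OF assms maps delta_pos, of m]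
    unfolding close_until_def by blast
  have "D n x y < \<epsilon>" if "x \<in> X n" "y \<in> X n" "d n x y < \<eta>" for n x y
    using \<eta>(2)[OF that] escape.chain_metric_le[of n x y] escape_dist_le_iff[OF that(1,2), of m] m
    by linarith
  then show "\<exists>\<eta>>0. \<forall>n. \<forall>x\<in>X n. \<forall>y\<in>X n. d n x y < \<eta> \<longrightarrow> D n x y < \<epsilon>"
    using \<open>\<eta> > 0\<close> by blast
qed

end

section \<open>Adapted metrics\<close>

definition adapted_sum ::
  "(nat \<Rightarrow> 'a \<Rightarrow> 'a \<Rightarrow> real) \<Rightarrow> (nat \<Rightarrow> 'a \<Rightarrow> 'a) \<Rightarrow> real \<Rightarrow> nat \<Rightarrow> nat \<Rightarrow> 'a \<Rightarrow> 'a \<Rightarrow> real" where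
  "adapted_sum D f \<beta> k n x y =
     (\<Sum>j<k. D (n + j) (NDS_iter f n j x) (NDS_iter f n j y) / \<beta> ^ j)"

lemma le_adapted_sum:
  assumes "\<And>n. Metric_space (X n) (D n)" "0 < k" "0 < \<beta>"
  shows "D n x y \<le> adapted_sum D f \<beta> k n x y"
proof -
  have "(\<Sum>j\<in>{0}. D (n + j) (NDS_iter f n j x) (NDS_iter f n j y) / \<beta> ^ j)
      \<le> adapted_sum D f \<beta> k n x y"
    unfolding adapted_sum_def
    using assms Metric_space.nonneg[OF assms(1)] by (intro sum_mono2) auto
  then show ?thesis by simp
qed

lemma Metric_space_adapted_sum:
  assumes metric: "\<And>n. Metric_space (X n) (D n)"
    and maps: "\<And>n. f n \<in> X n \<rightarrow> X (Suc n)"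
    and "0 < k" "0 < \<beta>"
  shows "Metric_space (X n) (adapted_sum D f \<beta> k n)"
proof
  have orbit: "NDS_iter f n j x \<in> X (n + j)" if "x \<in> X n" for x j
    using that by (rule NDS_iter_in[where X = X and f = f, OF maps])
  fix x y z
  show "0 \<le> adapted_sum D f \<beta> k n x y"
    unfolding adapted_sum_def
    using assms Metric_space.nonneg[OF metric] by (intro sum_nonneg) auto
  show "adapted_sum D f \<beta> k n x y = adapted_sum D f \<beta> k n y x"
    unfolding adapted_sum_def using Metric_space.commute[OF metric] by simp
  show "adapted_sum D f \<beta> k n x y = 0 \<longleftrightarrow> x = y" if xy: "x \<in> X n" "y \<in> X n"
  proof
    assume "adapted_sum D f \<beta> k n x y = 0"
    moreover have "D n x y \<le> adapted_sum D f \<beta> k n x y"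
      by (rule le_adapted_sum[where X = X]) (fact metric assms(3,4))+
    ultimately have "D n x y = 0"
      using Metric_space.nonneg[OF metric, of n x y] by simp
    then show "x = y" using Metric_space.zero[OF metric xy] by simp
  next
    assume "x = y"
    moreover have "D (n + j) (NDS_iter f n j y) (NDS_iter f n j y) = 0" for j
      using Metric_space.zero[OF metric orbit orbit] xy by blast
    ultimately show "adapted_sum D f \<beta> k n x y = 0"
      by (simp add: adapted_sum_def)
  qed
  show "adapted_sum D f \<beta> k n x z \<le> adapted_sum D f \<beta> k n x y + adapted_sum D f \<beta> k n y z"
    if "x \<in> X n" "y \<in> X n" "z \<in> X n"
  proof -
    have "D (n + j) (NDS_iter f n j x) (NDS_iter f n j z) / \<beta> ^ j
        \<le> D (n + j) (NDS_iter f n j x) (NDS_iter f n j y) / \<beta> ^ j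
          + D (n + j) (NDS_iter f n j y) (NDS_iter f n j z) / \<beta> ^ j" for j
      using Metric_space.triangle[OF metric orbit orbit orbit, OF that, of j] \<open>0 < \<beta>\<close>
      by (simp add: add_divide_distrib[symmetric] divide_right_mono)
    then show ?thesis
      unfolding adapted_sum_def sum.distrib[symmetric] by (intro sum_mono)
  qed
qed

text \<open>
  Applying \<open>f\<close> shifts the weighted sum by one place: up to the factor \<open>\<beta>\<close>, the term at time \<open>0\<close> is
  lost and a term at time \<open>k\<close> is gained. Expansion over \<open>k\<close> steps says that the gain covers the loss.
\<close>

lemma adapted_sum_expands:
  assumes "0 < \<beta>"
    and "\<beta> ^ k * D n x y \<le> D (n + k) (NDS_iter f n k x) (NDS_iter f n k y)"
  shows "\<beta> * adapted_sum D f \<beta> k n x y \<le> adapted_sum D f \<beta> k (Suc n) (f n x) (f n y)"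
proof -
  define t where "t j = D (n + j) (NDS_iter f n j x) (NDS_iter f n j y) / \<beta> ^ j" for j
  have "adapted_sum D f \<beta> k (Suc n) (f n x) (f n y) = \<beta> * (\<Sum>j<k. t (Suc j))"
    unfolding adapted_sum_def NDS_iter_Suc t_def sum_distrib_left
    using \<open>0 < \<beta>\<close> by (intro sum.cong) auto
  also have "(\<Sum>j<k. t (Suc j)) = (\<Sum>j<k. t j) - t 0 + t k"
    using sum.lessThan_Suc_shift[of t k] sum.lessThan_Suc[of t k] by simp
  finally have eq: "adapted_sum D f \<beta> k (Suc n) (f n x) (f n y)
      = \<beta> * ((\<Sum>j<k. t j) - t 0 + t k)" .
  have "t 0 \<le> t k"
    using assms by (simp add: t_def field_simps)
  then have "\<beta> * (\<Sum>j<k. t j) \<le> \<beta> * ((\<Sum>j<k. t j) - t 0 + t k)"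
    using \<open>0 < \<beta>\<close> by simp
  then show ?thesis
    unfolding eq by (simp add: adapted_sum_def t_def)
qed

lemma adapted_sum_uniformly_coarser:
  assumes equi: "equicontinuous_NDS X d f"
    and maps: "\<And>n. f n \<in> X n \<rightarrow> X (Suc n)"
    and metric: "\<And>n. Metric_space (X n) (D n)"
    and coarser: "uniformly_equicontinuous X d D (\<lambda>n x. x)"
    and "0 < k" "1 < \<beta>"
  shows "uniformly_equicontinuous X d (adapted_sum D f \<beta> k) (\<lambda>n x. x)"
  unfolding uniformly_equicontinuous_def
proof (intro allI impI)
  have orbit: "NDS_iter f n j x \<in> X (n + j)" if "x \<in> X n" for n x j
    using that by (rule NDS_iter_in[where X = X and f = f, OF maps])
  fix \<epsilon> :: real assume "0 < \<epsilon>"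
  then have "0 < \<epsilon> / k" using \<open>0 < k\<close> by simp
  then obtain \<eta> where \<eta>: "\<eta> > 0"
    "\<forall>n. \<forall>x\<in>X n. \<forall>y\<in>X n. d n x y < \<eta> \<longrightarrow> D n x y < \<epsilon> / k"
    using coarser[unfolded uniformly_equicontinuous_def, rule_format, of "\<epsilon> / k"] by auto
  obtain \<eta>' where \<eta>': "\<eta>' > 0" "\<forall>n. \<forall>x\<in>X n. \<forall>y\<in>X n. d n x y < \<eta>' \<longrightarrow>
      (\<forall>j<k. d (n + j) (NDS_iter f n j x) (NDS_iter f n j y) < \<eta>)"
    using equicontinuous_orbits[where X = X and f = f, OF equi maps \<open>\<eta> > 0\<close>, of k]
    by (elim exE conjE) (rule that)
  have "adapted_sum D f \<beta> k n x y < \<epsilon>" if xy: "x \<in> X n" "y \<in> X n" "d n x y < \<eta>'" for n x y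
  proof -
    have "D (n + j) (NDS_iter f n j x) (NDS_iter f n j y) / \<beta> ^ j < \<epsilon> / k" if "j < k" for j
    proof -
      have "D (n + j) (NDS_iter f n j x) (NDS_iter f n j y) / \<beta> ^ j
          \<le> D (n + j) (NDS_iter f n j x) (NDS_iter f n j y) / 1"
        using \<open>1 < \<beta>\<close> Metric_space.nonneg[OF metric, of "n + j"]
        by (intro divide_left_mono) simp_all
      also have "\<dots> < \<epsilon> / k"
        using \<eta>(2)[rule_format, of "NDS_iter f n j x" "n + j" "NDS_iter f n j y"]
          \<eta>'(2)[rule_format, OF xy that] orbit xy
        by simp
      finally show ?thesis .
    qed
    then have "adapted_sum D f \<beta> k n x y < (\<Sum>j<k. \<epsilon> / k)"
      unfolding adapted_sum_def using \<open>0 < k\<close> by (intro sum_strict_mono) auto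
    then show ?thesis using \<open>0 < k\<close> by simp
  qed
  then show "\<exists>\<eta>>0. \<forall>n. \<forall>x\<in>X n. \<forall>y\<in>X n. d n x y < \<eta> \<longrightarrow> adapted_sum D f \<beta> k n x y < \<epsilon>"
    using \<open>\<eta>' > 0\<close> by blast
qed

section \<open>Expanding metrics for expansive systems\<close>

theorem theorem7p18:
  fixes X :: "nat \<Rightarrow> 'a set"
    and d :: "nat \<Rightarrow> 'a \<Rightarrow> 'a \<Rightarrow> real"
    and f :: "nat \<Rightarrow> 'a \<Rightarrow> 'a"
  assumes "topological_NDS X d f"
    and "equicontinuous_NDS X d f"
    and "strongly_uniformly_expansive X d f"
    and "\<And>n. f n ` X n = X (Suc n)"
  shows "\<exists>\<rho> :: nat \<Rightarrow> 'a \<Rightarrow> 'a \<Rightarrow> real.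
           (\<forall>n. Metric_space (X n) (\<rho> n)) \<and>
           uniformly_expands_small_distances X \<rho> f \<and>
           uniformly_equivalent_metrics X d \<rho>"
proof -
  obtain \<delta> where "\<delta> > 0" and expansive: "\<And>\<epsilon>. \<epsilon> > 0 \<Longrightarrow> \<exists>N\<ge>1. \<forall>n. \<forall>x\<in>X n. \<forall>y\<in>X n.
      Bowen_metric d f n N x y < \<delta> \<longrightarrow> d n x y < \<epsilon>"
    using assms(3) unfolding strongly_uniformly_expansive_def by blast
  obtain N where N: "N \<ge> 1" "\<And>n x y. \<lbrakk>x \<in> X n; y \<in> X n; Bowen_metric d f n N x y < \<delta>\<rbrakk>
      \<Longrightarrow> d n x y < \<delta> / 3"
    using expansive[of "\<delta> / 3"] \<open>\<delta> > 0\<close> by auto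
  define \<theta> where "\<theta> = root N (1 / 2)"
  have \<theta>: "0 < \<theta>" "\<theta> < 1" "\<theta> ^ N = 1 / 2"
    unfolding \<theta>_def using N(1) by auto
  have maps: "f n \<in> X n \<rightarrow> X (Suc n)" for n
    using assms(4)[of n] by blast
  interpret expansive_NDS X d f \<delta> \<theta> N
  proof (rule expansive_NDS.intro)
    show "Metric_space (X n) (d n)" for n
      using assms(1) by (simp add: topological_NDS_def)
    show "\<exists>M. \<forall>n. \<forall>x\<in>X n. \<forall>y\<in>X n. Bowen_metric d f n M x y < \<delta> \<longrightarrow> d n x y < \<epsilon>"
      if "0 < \<epsilon>" for \<epsilon>
      using expansive[OF that] by blast
  qed (fact maps \<open>\<delta> > 0\<close> \<theta> N(2))+
  \<comment> \<open>The \<open>2 * N\<close>-th root of the expansion that \<open>2 * N\<close> steps achieve for \<open>D\<close>.\<close>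
  define \<beta> where "\<beta> = root (2 * N) 2"
  have \<beta>: "1 < \<beta>" "\<beta> ^ (2 * N) = 2"
    unfolding \<beta>_def using N(1) by auto
  have pos: "0 < 2 * N" "0 < \<beta>" using N(1) \<beta>(1) by auto
  define \<rho> where "\<rho> = adapted_sum D f \<beta> (2 * N)"
  have D_le: "D n x y \<le> \<rho> n x y" for n x y
    unfolding \<rho>_def
    by (rule le_adapted_sum[where X = X]) (fact escape.Metric_space_chain_metric pos)+
  have "Metric_space (X n) (\<rho> n)" for n
    unfolding \<rho>_def
    by (rule Metric_space_adapted_sum) (fact escape.Metric_space_chain_metric maps pos)+
  moreover have "uniformly_expands_small_distances X \<rho> f"
  proof -
    have "\<beta> * \<rho> n x y \<le> \<rho> (Suc n) (f n x) (f n y)"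
      if "x \<in> X n" "y \<in> X n" "\<rho> n x y < \<theta> ^ (2 * N) / 2" for n x y
      using adapted_sum_expands[of \<beta> "2 * N" D n x y f] chain_metric_doubles[of x n y]
        D_le[of n x y] that \<beta> pos unfolding \<rho>_def by auto
    moreover have "0 < \<theta> ^ (2 * N) / 2" using \<theta>(1) by simp
    ultimately show ?thesis
      using \<beta>(1) unfolding uniformly_expands_small_distances_def by blast
  qed
  moreover have "uniformly_equicontinuous X d \<rho> (\<lambda>n x. x)"
    unfolding \<rho>_def
    by (rule adapted_sum_uniformly_coarser)
      (fact assms(2) maps escape.Metric_space_chain_metric
        chain_metric_uniformly_coarser[OF assms(2)] pos(1) \<beta>(1))+
  moreover have "uniformly_equicontinuous X \<rho> d (\<lambda>n x. x)"
    using chain_metric_uniformly_finer D_le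
    unfolding uniformly_equicontinuous_def by (meson order_le_less_trans)
  ultimately show ?thesis
    unfolding uniformly_equivalent_metrics_def by blast
qed

end
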